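(* Let $a_0,a_1,a_2\in\mathbb C$ with $a_2\ne0$, put $a_{-2}=a_2$, $a_{-1}=a_1$ and $a_s=0$ for $|s|>2$, and let $A_n=(a_{j-i})_{i,j=1}^n$. Let $X_n^{(-1)}=\det A_n$ and $X_n^{(+1)}=\operatorname{perm}A_n$. Then for each $\varepsilon\in\{-1,+1\}$ the minimal recurrence degree of $(X_n^{(\varepsilon)})_{n\ge0}$ is $$\deg_{\min}X^{(\varepsilon)}=\begin{cases}5,&a_1\neq0,\\4,&a_1=0.\end{cases}$$ On the exceptional hyperplane $a_1=0$, put $F_0=1$, $F_1=a_0$, $F_{k+2}=a_0F_{k+1}+\varepsilon a_2^2F_k$. Then for all $k,n\ge0$ $$X_{2k}^{(\varepsilon)}=F_k^2,\qquad X_{2k+1}^{(\varepsilon)}=F_kF_{k+1},$$ $$X_{n+4}^{(\varepsilon)}=a_0X_{n+3}^{(\varepsilon)}+\varepsilon a_0a_2^2X_{n+1}^{(\varepsilon)}+a_2^4X_n^{(\varepsilon)},$$ and equivalently $$\sum_{n\ge0}X_n^{(\varepsilon)}z^n=\frac1{1-a_0z-\varepsilon a_0a_2^2z^3-a_2^4z^4}.$$ Thus, on the genuine symmetric pentadiagonal locus $a_2\ne0$, $a_1=0$ is exactly a one-step recurrence-degree drop for both determinants and permanents.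
   Context: $\operatorname{perm}$ denotes the permanent; $X_0^{(\varepsilon)}=1$. The minimal recurrence degree of $(u_n)_{n\ge0}$ is the least $d$ for which there are constants $c_1,\dots,c_d$ with $u_{n+d}+c_1u_{n+d-1}+\dots+c_du_n=0$ for all $n\ge0$. *)

theory Defs
  imports
    "Jordan_Normal_Form.Determinant"
    "HOL-Computational_Algebra.Formal_Power_Series"
    "HOL-Library.Extended_Nat"
begin

definition perm :: "'a mat \<Rightarrow> 'a :: comm_ring_1" where
  "perm A = (if dim_row A = dim_col A
     then \<Sum>p \<in> {p. p permutes {0..<dim_row A}}. \<Prod>i = 0..<dim_row A. A $$ (i, p i) else 0)"

text \<open>Matrix indices start at 0 here; the entry depends only on \<open>j - i\<close>, so the shift is harmless.\<close>

definition toeplitz_mat :: "(int \<Rightarrow> 'a) \<Rightarrow> nat \<Rightarrow> 'a mat" where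
  "toeplitz_mat a n = mat n n (\<lambda>(i, j). a (int j - int i))"

text \<open>The sign \<open>e\<close> is meant to range over \<open>{-1, 1}\<close> only.\<close>

definition toeplitz_seq :: "int \<Rightarrow> (int \<Rightarrow> 'a) \<Rightarrow> nat \<Rightarrow> 'a :: comm_ring_1" where
  "toeplitz_seq e a n = (if e = -1 then det (toeplitz_mat a n) else perm (toeplitz_mat a n))"

lemma toeplitz_seq_0: "toeplitz_seq e a 0 = 1"
  by (simp add: toeplitz_seq_def toeplitz_mat_def det_def perm_def)

text \<open>The trailing coefficient \<open>c d\<close> is allowed to vanish.\<close>

definition satisfies_recurrence :: "(nat \<Rightarrow> complex) \<Rightarrow> nat \<Rightarrow> bool" where
  "satisfies_recurrence u d \<longleftrightarrow>
     (\<exists>c :: nat \<Rightarrow> complex. \<forall>n. u (n + d) + (\<Sum>i = 1..d. c i * u (n + d - i)) = 0)"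

text \<open>Taken in \<^typ>\<open>enat\<close>, so that a sequence satisfying no recurrence has degree \<open>\<infinity>\<close>;
  a finite value is attained and is the least \<open>d\<close> with \<open>satisfies_recurrence u d\<close>.\<close>

definition min_recurrence_degree :: "(nat \<Rightarrow> complex) \<Rightarrow> enat" where
  "min_recurrence_degree u = (INF d \<in> {d. satisfies_recurrence u d}. enat d)"

fun F_seq :: "int \<Rightarrow> complex \<Rightarrow> complex \<Rightarrow> nat \<Rightarrow> complex" where
  "F_seq e a0 a2 0 = 1"
| "F_seq e a0 a2 (Suc 0) = a0"
| "F_seq e a0 a2 (Suc (Suc k)) = a0 * F_seq e a0 a2 (Suc k) + of_int e * a2\<^sup>2 * F_seq e a0 a2 k"

end

theory Submission
  imports Defs "HOL-Computational_Algebra.Polynomial_FPS"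
    "HOL-Computational_Algebra.Polynomial_Factorial"
    "HOL-Computational_Algebra.Field_as_Ring"
begin

text \<open>Expanding determinant and permanent alike along the first row, with sign \<open>e\<^sup>j\<close> in column \<open>j\<close>,
  yields a linear system for the generating functions of the six kinds of minors that arise by
  deleting initial rows of the band matrix.  For the entries \<open>A, B, C\<close> on the diagonals
  0, 1, 2 and the generating function \<open>P\<close> of the full minors, the symmetric system collapses, after cancelling the factor \<open>1 + e C z\<close>, to
  \<open>P (N K - e B\<^sup>2 z\<^sup>2 (1 + e C z)) = N\<close> with \<open>N = 1 - e C z\<close> and
  \<open>K = 1 - A z - e A C\<^sup>2 z\<^sup>3 - C\<^sup>4 z\<^sup>4\<close>.  At the root \<open>e / C\<close> of \<open>N\<close> the denominator is
  \<open>-2 e B\<^sup>2 / C\<^sup>2\<close>, so the fraction is reduced, of degree 5, unless \<open>B = 0\<close>, when \<open>N\<close> cancels and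
  leaves \<open>1 / K\<close>.\<close>

section \<open>First-row expansion of permanents and determinants\<close>

text \<open>Permutations are grouped by the image \<open>j\<close> of 0;
  \<open>permutation_insert 0 j\<close> turns permutations of \<open>n\<close> points bijectively
  into those sending 0 to \<open>j\<close>.\<close>

lemma perm_expansion_row_0:
  fixes A :: "'a :: comm_ring_1 mat"
  assumes A: "A \<in> carrier_mat (Suc n) (Suc n)"
  shows "perm A = (\<Sum>j<Suc n. A $$ (0, j) * perm (mat_delete A 0 j))"
proof -
  let ?N = "{0..<Suc n}"
  let ?Q = "{q. q permutes {0..<n}}"
  define h where "h p = (\<Prod>i = 0..<Suc n. A $$ (i, p i))" for p
  have "perm A = sum h {p. p permutes ?N}"
    using A by (simp add: perm_def h_def)
  also have "\<dots> = (\<Sum>j\<in>?N. sum h {p. p permutes ?N \<and> p 0 = j})"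
  proof -
    have "(\<lambda>p. p 0) ` {p. p permutes ?N} \<subseteq> ?N"
      using permutes_in_image[of _ ?N 0] by fastforce
    from sum.group[OF _ _ this, of h, symmetric] show ?thesis
      by (simp add: finite_permutations)
  qed
  also have "\<dots> = (\<Sum>j\<in>?N. A $$ (0, j) * perm (mat_delete A 0 j))"
  proof (rule sum.cong[OF refl])
    fix j assume "j \<in> ?N"
    hence j: "j < Suc n" by simp
    have "sum h {p. p permutes ?N \<and> p 0 = j} = sum h (permutation_insert 0 j ` ?Q)"
      using permutation_fix[OF _ j] by simp
    also have "\<dots> = (\<Sum>q\<in>?Q. h (permutation_insert 0 j q))"
      by (subst sum.reindex[OF permutation_insert_inj_on[OF _ j]]) auto
    also have "\<dots> = (\<Sum>q\<in>?Q. A $$ (0, j) * (\<Prod>i = 0..<n. mat_delete A 0 j $$ (i, q i)))"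
    proof (rule sum.cong[OF refl])
      fix q assume "q \<in> ?Q"
      hence q: "q i < n" if "i < n" for i
        using that permutes_in_image[of q "{0..<n}" i] by auto
      have "h (permutation_insert 0 j q) =
          A $$ (0, j) * (\<Prod>i = 0..<n. A $$ (Suc i, permutation_insert 0 j q (Suc i)))"
        unfolding h_def by (simp only: prod.atLeast0_lessThan_Suc_shift)
          (simp add: o_def)
      also have "(\<Prod>i = 0..<n. A $$ (Suc i, permutation_insert 0 j q (Suc i))) =
          (\<Prod>i = 0..<n. mat_delete A 0 j $$ (i, q i))"
        by (rule prod.cong[OF refl])
          (use A j q in \<open>auto simp: mat_delete_def permutation_insert_expand\<close>)
      finally show "h (permutation_insert 0 j q) =
          A $$ (0, j) * (\<Prod>i = 0..<n. mat_delete A 0 j $$ (i, q i))" .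
    qed
    also have "\<dots> = A $$ (0, j) * perm (mat_delete A 0 j)"
      using A by (simp add: perm_def sum_distrib_left)
    finally show "sum h {p. p permutes ?N \<and> p 0 = j} = A $$ (0, j) * perm (mat_delete A 0 j)" .
  qed
  finally show ?thesis by (simp only: atLeast0LessThan)
qed

definition signed_perm :: "int \<Rightarrow> 'a :: comm_ring_1 mat \<Rightarrow> 'a" where
  "signed_perm e A = (if e = -1 then det A else perm A)"

lemma signed_perm_expansion_row_0:
  fixes A :: "'a :: comm_ring_1 mat"
  assumes A: "A \<in> carrier_mat (Suc n) (Suc n)" and e: "e \<in> {-1, 1}"
  shows "signed_perm e A =
    (\<Sum>j<Suc n. A $$ (0, j) * of_int e ^ j * signed_perm e (mat_delete A 0 j))"
proof (cases "e = -1")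
  case True
  thus ?thesis
    using laplace_expansion_row[OF A, of 0]
    by (simp add: signed_perm_def cofactor_def mult.assoc del: sum.lessThan_Suc)
next
  case False
  with e have "e = 1" by simp
  thus ?thesis
    using perm_expansion_row_0[OF A] by (simp add: signed_perm_def del: sum.lessThan_Suc)
qed

section \<open>Minors of the band matrix\<close>

text \<open>Deleting the first rows of a pentadiagonal Toeplitz matrix together with as many columns,
  such that no zero column is left over, changes only the first two columns.  They are recorded by
  their offsets \<open>u\<close> and \<open>v\<close> relative to the first remaining row.\<close>

definition band_mat :: "(int \<Rightarrow> 'a) \<Rightarrow> nat \<Rightarrow> int \<Rightarrow> int \<Rightarrow> 'a mat" where
  "band_mat a n u v =
     mat n n (\<lambda>(i, j). a ((if j = 0 then u else if j = 1 then v else int j) - int i))"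

text \<open>The columns of offset at least \<open>n\<close> are cut off.  For \<open>n < 2\<close> this can make the remaining
  array non-square, and the value 0 then keeps the recurrence below valid from \<open>n = 0\<close> on.\<close>

definition band_minor :: "int \<Rightarrow> (int \<Rightarrow> 'a) \<Rightarrow> nat \<Rightarrow> int \<Rightarrow> int \<Rightarrow> 'a :: comm_ring_1" where
  "band_minor e a n u v =
     (if n = 0 \<and> u < 0 \<or> n = 1 \<and> v < 1 then 0 else signed_perm e (band_mat a n u v))"

lemma toeplitz_seq_eq_band_minor: "toeplitz_seq e a n = band_minor e a n 0 1"
proof -
  have "toeplitz_mat a n = band_mat a n 0 1"
    by (rule eq_matI) (auto simp: toeplitz_mat_def band_mat_def)
  thus ?thesis
    by (simp add: toeplitz_seq_def band_minor_def signed_perm_def)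
qed

text \<open>Removing the top row lowers every offset by one, and removing one of the first three
  columns moves later columns one place left, so their offsets match their positions again. The
  family is therefore closed under the expansion.\<close>

lemma mat_delete_band_mat:
  "mat_delete (band_mat a (Suc n) u v) 0 0 = band_mat a n (v - 1) 1"
  "mat_delete (band_mat a (Suc n) u v) 0 (Suc 0) = band_mat a n (u - 1) 1"
  "mat_delete (band_mat a (Suc n) u v) 0 2 = band_mat a n (u - 1) (v - 1)"
  by (rule eq_matI; force simp: mat_delete_def band_mat_def algebra_simps)+

lemma signed_perm_band_mat_0: "signed_perm e (band_mat a 0 u v) = 1"
  by (simp add: signed_perm_def band_mat_def perm_def det_def)

lemma band_minor_Suc:
  fixes a :: "int \<Rightarrow> 'a :: comm_ring_1"
  assumes band: "\<And>s. s > 2 \<Longrightarrow> a s = 0" and e: "e \<in> {-1, 1}" and uv: "u < v" "v \<le> 1"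
  shows "band_minor e a (Suc n) u v =
    a u * band_minor e a n (v - 1) 1 + of_int e * a v * band_minor e a n (u - 1) 1
      + a 2 * band_minor e a n (u - 1) (v - 1)"
proof -
  let ?B = "band_mat a (Suc n) u v"
  have expand: "signed_perm e ?B =
      (\<Sum>j<Suc n. ?B $$ (0, j) * of_int e ^ j * signed_perm e (mat_delete ?B 0 j))"
    by (rule signed_perm_expansion_row_0[OF _ e]) (simp add: band_mat_def)
  consider "n = 0" | "n = 1" | m where "n = Suc (Suc m)"
    by (metis One_nat_def not0_implies_Suc)
  thus ?thesis
  \<comment> \<open>For \<open>n = 0\<close> and \<open>n = 1\<close> the expansion terms of columns
    that the matrix lacks are exactly those killed by the default value 0 of
    \<open>band_minor\<close>.\<close>
  proof cases
    case 1
    thus ?thesis using uv expand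
      by (auto simp: band_minor_def mat_delete_band_mat signed_perm_band_mat_0)
        (auto simp: band_mat_def)
  next
    case 2
    thus ?thesis using uv expand
      by (auto simp: band_minor_def mat_delete_band_mat)
        (auto simp: band_mat_def algebra_simps)
  next
    case (3 m)
    \<comment> \<open>Column \<open>j > 2\<close> has the entry \<open>a j = 0\<close> in the top
      row.\<close>
    have "signed_perm e ?B =
        (\<Sum>j\<in>{0,1,2}. ?B $$ (0, j) * of_int e ^ j * signed_perm e (mat_delete ?B 0 j))"
      unfolding expand using 3 band
      by (intro sum.mono_neutral_right) (auto simp: band_mat_def)
    also have "\<dots> = a u * signed_perm e (band_mat a n (v - 1) 1)
        + of_int e * a v * signed_perm e (band_mat a n (u - 1) 1)
        + a 2 * of_int e ^ 2 * signed_perm e (band_mat a n (u - 1) (v - 1))"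
      using 3 by (simp add: mat_delete_band_mat) (simp add: band_mat_def algebra_simps)
    also have "(of_int e :: 'a) ^ 2 = 1"
      using e by auto
    finally show ?thesis
      using 3 by (simp add: band_minor_def)
  qed
qed

text \<open>The first column lies wholly outside the band. In the recurrence, the first term carries
  \<open>a u = 0\<close> and the other two keep this column, at offset \<open>u - 1\<close>. This
  makes the linear system finite.\<close>

lemma band_minor_eq_0:
  fixes a :: "int \<Rightarrow> 'a :: comm_ring_1"
  assumes band: "\<And>s. \<bar>s\<bar> > 2 \<Longrightarrow> a s = 0" and e: "e \<in> {-1, 1}"
    and "u < v" "v \<le> 1" "u < -2"
  shows "band_minor e a n u v = 0"
  using assms(3-)
proof (induction n arbitrary: u v)
  case 0
  thus ?case by (simp add: band_minor_def)
next
  case (Suc n)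
  thus ?case using band by (simp add: band_minor_Suc[OF _ e])
qed

section \<open>The generating function\<close>

lemma fps_eq_const_add_X_mult:
  fixes f :: "nat \<Rightarrow> 'a :: comm_ring_1"
  shows "Abs_fps f = fps_const (f 0) + fps_X * Abs_fps (\<lambda>n. f (Suc n))"
  by (rule fps_ext) simp

lemma Abs_fps_add: "Abs_fps (\<lambda>n. f n + g n) = Abs_fps f + Abs_fps g"
  by (rule fps_ext) simp

lemma Abs_fps_cmult: "Abs_fps (\<lambda>n. c * f n :: 'a :: comm_ring_1) = fps_const c * Abs_fps f"
  by (rule fps_ext) (simp only: fps_mult_left_const_nth fps_nth_Abs_fps)

text \<open>Keeping \<open>E\<close> abstract with \<open>E * E = 1\<close> treats both signs at
  once. The hypothesis on \<open>Q\<close> says \<open>(1 - C^2 X^2) Q = B X (1 + E C X) P\<close>,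
  whose left factor splits as \<open>(1 + E C X) (1 - E C X)\<close>.\<close>

lemma pentadiagonal_elimination:
  fixes P :: "'a :: idom"
  assumes P: "P = 1 + X * (A * P + E * B * Q
      + C * (X * (B * Q + E * A * (X * C * P) + C * (X * C * (X * C * P)))))"
    and Q: "Q = X * (B * P + E * B * (X * C * P) + C * (X * C * Q))"
    and E: "E * E = 1" and nz: "1 + E * C * X \<noteq> 0"
  shows "((1 - E * C * X) * (1 - A * X - E * A * C\<^sup>2 * X ^ 3 - C ^ 4 * X ^ 4)
           - E * B\<^sup>2 * X\<^sup>2 * (1 + E * C * X)) * P = 1 - E * C * X"
proof -
  have "(1 + E * C * X) * ((1 - E * C * X) * Q) = (1 + E * C * X) * (B * X * P)"
  proof -
    have "(1 + E * C * X) * ((1 - E * C * X) * Q) - (1 + E * C * X) * (B * X * P) =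
        (Q - X * (B * P + E * B * (X * C * P) + C * (X * C * Q))) + (1 - E * E) * (C\<^sup>2 * X\<^sup>2 * Q)"
      by (simp add: algebra_simps power2_eq_square)
    also have "\<dots> = 0" using Q E by simp
    finally show ?thesis by simp
  qed
  hence Q': "(1 - E * C * X) * Q = B * X * P" using nz by simp
  \<comment> \<open>\<open>Q\<close> is eliminated by multiplying the equation for \<open>P\<close>
    by \<open>1 - E * C * X\<close>; the last summand accounts for the use of
    \<open>E * E = 1\<close>.\<close>
  have "((1 - E * C * X) * (1 - A * X - E * A * C\<^sup>2 * X ^ 3 - C ^ 4 * X ^ 4)
           - E * B\<^sup>2 * X\<^sup>2 * (1 + E * C * X)) * P - (1 - E * C * X) =
      (1 - E * C * X) * (P - (1 + X * (A * P + E * B * Q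
        + C * (X * (B * Q + E * A * (X * C * P) + C * (X * C * (X * C * P)))))))
      + X * (E * B + C * X * B) * ((1 - E * C * X) * Q - B * X * P)
      + (1 - E * E) * (B\<^sup>2 * C * X ^ 3 * P)"
    by (simp add: algebra_simps eval_nat_numeral)
  also have "\<dots> = 0" using P Q' E by simp
  finally show ?thesis by simp
qed

lemma pentadiagonal_gf:
  fixes a :: "int \<Rightarrow> complex"
  assumes sym: "a (-2) = a 2" "a (-1) = a 1"
    and band: "\<And>s. \<bar>s\<bar> > 2 \<Longrightarrow> a s = 0" and e: "e \<in> {-1, 1}"
  defines "A \<equiv> fps_const (a 0)" and "B \<equiv> fps_const (a 1)" and "C \<equiv> fps_const (a 2)"
    and "E \<equiv> fps_const (of_int e)" and "X \<equiv> fps_X"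
  shows "((1 - E * C * X) * (1 - A * X - E * A * C\<^sup>2 * X ^ 3 - C ^ 4 * X ^ 4)
           - E * B\<^sup>2 * X\<^sup>2 * (1 + E * C * X)) * Abs_fps (toeplitz_seq e a) = 1 - E * C * X"
proof -
  have band': "a s = 0" if "s > 2" for s using band that by simp
  define G where "G u v = Abs_fps (\<lambda>n. band_minor e a n u v)" for u v
  have rec: "G u v = (if 0 \<le> u then 1 else 0) + X * (fps_const (a u) * G (v - 1) 1
      + E * fps_const (a v) * G (u - 1) 1 + C * G (u - 1) (v - 1))"
    if "u < v" "v \<le> 1" for u v
  proof -
    have "G u v = (if 0 \<le> u then 1 else 0) + X * Abs_fps (\<lambda>n. a u * band_minor e a n (v - 1) 1
        + of_int e * a v * band_minor e a n (u - 1) 1 + a 2 * band_minor e a n (u - 1) (v - 1))"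
      unfolding G_def X_def
      by (subst fps_eq_const_add_X_mult)
        (auto simp: band_minor_Suc[OF band' e that], auto simp: band_minor_def signed_perm_band_mat_0)
    thus ?thesis
      by (simp add: Abs_fps_add Abs_fps_cmult G_def C_def E_def)
  qed
  have zero: "G u v = 0" if "u < v" "v \<le> 1" "u < -2" for u v
    using band_minor_eq_0[OF band e that] by (simp add: G_def fps_zero_def)
  define P where "P = G 0 1"
  define Q where "Q = G (-1) 1"
  have E2: "E * E = 1" using e by (auto simp: E_def)
  \<comment> \<open>With first offset -2, only the term of \<open>a (-2)\<close> survives by
    \<open>zero\<close>. This expresses \<open>S\<close>, \<open>T\<close>, \<open>U\<close> and
    then \<open>R\<close> through \<open>P\<close> and \<open>Q\<close>.\<close>
  have S: "G (-2) 1 = X * C * P"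
    using rec[of "-2" 1] by (simp add: zero sym P_def C_def)
  have T: "G (-2) 0 = X * C * Q"
    using rec[of "-2" 0] by (simp add: zero sym Q_def C_def)
  have U: "G (-2) (-1) = X * C * (X * C * P)"
    using rec[of "-2" "-1"] by (simp add: zero sym S C_def)
  have R: "G (-1) 0 = X * (B * Q + E * A * (X * C * P) + C * (X * C * (X * C * P)))"
    using rec[of "-1" 0] by (simp add: sym S U Q_def A_def B_def)
  have Q: "Q = X * (B * P + E * B * (X * C * P) + C * (X * C * Q))"
    using rec[of "-1" 1] by (simp add: sym S T P_def Q_def B_def)
  have P: "P = 1 + X * (A * P + E * B * Q
      + C * (X * (B * Q + E * A * (X * C * P) + C * (X * C * (X * C * P)))))"
    using rec[of 0 1] by (simp add: R P_def Q_def A_def B_def)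
  have "1 + E * C * X \<noteq> 0"
  proof
    assume "1 + E * C * X = 0"
    hence "fps_nth (1 + E * C * X) 0 = 0" by simp
    thus False by (simp add: X_def E_def C_def)
  qed
  moreover have "Abs_fps (toeplitz_seq e a) = P"
    by (simp add: P_def G_def toeplitz_seq_eq_band_minor[abs_def])
  ultimately show ?thesis
    using pentadiagonal_elimination[OF P Q E2] by simp
qed

section \<open>Recurrence degree and rational generating functions\<close>

text \<open>\<open>Q\<close> is the reversed characteristic polynomial
  \<open>1 + c 1 z + ... + c d z^d\<close>; its degree may be below \<open>d\<close> because
  \<open>c d\<close> may vanish.\<close>

lemma satisfies_recurrence_iff_poly:
  "satisfies_recurrence u d \<longleftrightarrow>
     (\<exists>Q. coeff Q 0 = 1 \<and> degree Q \<le> d \<and> (\<forall>n\<ge>d. fps_nth (fps_of_poly Q * Abs_fps u) n = 0))"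
proof -
  have nth: "fps_nth (fps_of_poly Q * Abs_fps u) (n + d) = u (n + d) + (\<Sum>i = 1..d. coeff Q i * u (n + d - i))"
    if "coeff Q 0 = 1" "degree Q \<le> d" for Q n
  proof -
    have "fps_nth (fps_of_poly Q * Abs_fps u) (n + d) = (\<Sum>i = 0..n + d. coeff Q i * u (n + d - i))"
      by (simp add: fps_mult_nth)
    also have "\<dots> = (\<Sum>i = 0..d. coeff Q i * u (n + d - i))"
      using that(2) by (intro sum.mono_neutral_right) (auto simp: coeff_eq_0)
    also have "\<dots> = u (n + d) + (\<Sum>i = 1..d. coeff Q i * u (n + d - i))"
      using that(1) by (simp add: sum.atLeast_Suc_atMost)
    finally show ?thesis .
  qed
  show ?thesis
  proof
    assume "satisfies_recurrence u d"
    then obtain c where c: "\<And>n. u (n + d) + (\<Sum>i = 1..d. c i * u (n + d - i)) = 0"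
      unfolding satisfies_recurrence_def by blast
    define Q where "Q = truncate_fps (Suc d) (Abs_fps (\<lambda>i. if i = 0 then 1 else c i))"
    have Q: "coeff Q 0 = 1" "degree Q \<le> d"
      using degree_truncate_fps[of "Suc d"] by (auto simp: Q_def coeff_truncate_fps less_Suc_eq_le)
    have "(\<Sum>i = 1..d. coeff Q i * u (n + d - i)) = (\<Sum>i = 1..d. c i * u (n + d - i))" for n
      by (rule sum.cong) (auto simp: Q_def coeff_truncate_fps)
    hence "fps_nth (fps_of_poly Q * Abs_fps u) (n + d) = 0" for n
      using nth[OF Q] c by simp
    with Q show "\<exists>Q. coeff Q 0 = 1 \<and> degree Q \<le> d \<and> (\<forall>n\<ge>d. fps_nth (fps_of_poly Q * Abs_fps u) n = 0)"
      by (metis le_add_diff_inverse2)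
  next
    assume "\<exists>Q. coeff Q 0 = 1 \<and> degree Q \<le> d \<and> (\<forall>n\<ge>d. fps_nth (fps_of_poly Q * Abs_fps u) n = 0)"
    then obtain Q where "coeff Q 0 = 1" "degree Q \<le> d"
        "\<forall>n\<ge>d. fps_nth (fps_of_poly Q * Abs_fps u) n = 0" by blast
    thus "satisfies_recurrence u d"
      unfolding satisfies_recurrence_def using nth[of Q] by (intro exI[of _ "coeff Q"]) simp
  qed
qed

text \<open>A recurrence of order \<open>d\<close> with polynomial \<open>Q\<close> writes the
  series as \<open>M / Q\<close>, so \<open>D * M = Q * N\<close>, and coprimality forces
  \<open>D\<close> to divide \<open>Q\<close>. Conversely \<open>D\<close> itself gives a
  recurrence, valid from index 0 on since \<open>degree N < degree D\<close>.\<close>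

lemma min_recurrence_degree_rational_gf:
  assumes gf: "fps_of_poly D * Abs_fps u = fps_of_poly N"
    and D0: "coeff D 0 = 1" and coprime: "coprime D N" and deg: "degree N < degree D"
  shows "min_recurrence_degree u = enat (degree D)"
proof (rule antisym)
  have "satisfies_recurrence u (degree D)"
    unfolding satisfies_recurrence_iff_poly
    using D0 deg by (intro exI[of _ D]) (auto simp: gf coeff_eq_0)
  thus "min_recurrence_degree u \<le> enat (degree D)"
    unfolding min_recurrence_degree_def by (intro INF_lower) simp
next
  show "enat (degree D) \<le> min_recurrence_degree u"
    unfolding min_recurrence_degree_def
  proof (rule INF_greatest)
    fix d assume "d \<in> {d. satisfies_recurrence u d}"
    then obtain Q where Q: "coeff Q 0 = 1" "degree Q \<le> d"
        "\<And>n. n \<ge> d \<Longrightarrow> fps_nth (fps_of_poly Q * Abs_fps u) n = 0"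
      unfolding satisfies_recurrence_iff_poly by blast
    define M where "M = truncate_fps d (fps_of_poly Q * Abs_fps u)"
    have "fps_of_poly M = fps_of_poly Q * Abs_fps u"
      using Q(3) by (intro fps_ext) (simp add: M_def coeff_truncate_fps)
    hence "fps_of_poly (D * M) = fps_of_poly (Q * N)"
      unfolding fps_of_poly_mult using gf by (metis mult.left_commute)
    hence "D dvd Q * N"
      by (metis fps_of_poly_eq_iff dvd_triv_left)
    hence "D dvd Q"
      using coprime by (simp add: coprime_dvd_mult_left_iff)
    moreover have "Q \<noteq> 0" using Q(1) by auto
    ultimately have "degree D \<le> degree Q" by (rule dvd_imp_degree_le)
    thus "enat (degree D) \<le> enat d" using Q(2) by simp
  qed
qed

section \<open>The degree drop and the product formulas\<close>

theorem corollary5p3: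
  fixes a :: "int \<Rightarrow> complex" and e :: int
  assumes "a 2 \<noteq> 0"
    and "a (-2) = a 2" and "a (-1) = a 1"
    and "\<And>s. \<bar>s\<bar> > 2 \<Longrightarrow> a s = 0"
    and "e \<in> {-1, 1}"
  shows "let X = toeplitz_seq e a; F = F_seq e (a 0) (a 2) in
    min_recurrence_degree X = (if a 1 \<noteq> 0 then 5 else 4) \<and>
    (a 1 = 0 \<longrightarrow>
      (\<forall>k. X (2 * k) = (F k)\<^sup>2 \<and> X (2 * k + 1) = F k * F (k + 1)) \<and>
      (\<forall>n. X (n + 4) =
         a 0 * X (n + 3) + of_int e * a 0 * (a 2)\<^sup>2 * X (n + 1) + (a 2) ^ 4 * X n) \<and>
      Abs_fps X =
         1 / (1 - fps_const (a 0) * fps_X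
                - fps_const (of_int e * a 0 * (a 2)\<^sup>2) * fps_X ^ 3
                - fps_const ((a 2) ^ 4) * fps_X ^ 4)) \<and>
    (a 1 = 0 \<longleftrightarrow> min_recurrence_degree X + 1 = 5)"
proof -
  define X where "X = toeplitz_seq e a"
  define F where "F = F_seq e (a 0) (a 2)"
  define \<epsilon> :: complex where "\<epsilon> = of_int e"
  have \<epsilon>2: "\<epsilon> * \<epsilon> = 1" using assms(5) by (auto simp: \<epsilon>_def)
  hence \<epsilon>2': "\<epsilon> * (\<epsilon> * x) = x" for x by (simp flip: mult.assoc)
  have \<epsilon>0: "\<epsilon> \<noteq> 0" using \<epsilon>2 by auto
  define N where "N = [:1, - \<epsilon> * a 2:]"
  define K where "K = [:1, - a 0, 0, - \<epsilon> * a 0 * (a 2)\<^sup>2, - ((a 2) ^ 4):]"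
  \<comment> \<open>The subtracted polynomial is \<open>e B^2 z^2 (1 + e C z)\<close> expanded with
    \<open>e^2 = 1\<close>.\<close>
  define D where "D = N * K - [:0, 0, \<epsilon> * (a 1)\<^sup>2, (a 1)\<^sup>2 * a 2:]"
  have N: "fps_of_poly N = 1 - fps_const \<epsilon> * fps_const (a 2) * fps_X"
    by (simp add: N_def fps_of_poly_simps algebra_simps flip: fps_const_neg)
  have K: "fps_of_poly K = 1 - fps_const (a 0) * fps_X
      - fps_const (\<epsilon> * a 0 * (a 2)\<^sup>2) * fps_X ^ 3 - fps_const ((a 2) ^ 4) * fps_X ^ 4"
    by (simp add: K_def fps_of_poly_simps algebra_simps eval_nat_numeral flip: fps_const_neg)
  have "fps_of_poly [:0, 0, \<epsilon> * (a 1)\<^sup>2, (a 1)\<^sup>2 * a 2:] =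
      fps_const \<epsilon> * (fps_const (a 1))\<^sup>2 * fps_X\<^sup>2 * (1 + fps_const \<epsilon> * fps_const (a 2) * fps_X)"
  proof -
    have "fps_const \<epsilon> * fps_const \<epsilon> = 1" using \<epsilon>2 by simp
    thus ?thesis
      by (simp add: fps_of_poly_simps algebra_simps eval_nat_numeral flip: fps_const_mult) algebra
  qed
  hence "fps_of_poly D = (1 - fps_const \<epsilon> * fps_const (a 2) * fps_X) *
       (1 - fps_const (a 0) * fps_X - fps_const \<epsilon> * fps_const (a 0) * (fps_const (a 2))\<^sup>2 * fps_X ^ 3
          - (fps_const (a 2)) ^ 4 * fps_X ^ 4)
       - fps_const \<epsilon> * (fps_const (a 1))\<^sup>2 * fps_X\<^sup>2 * (1 + fps_const \<epsilon> * fps_const (a 2) * fps_X)"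
    by (simp add: D_def fps_of_poly_simps N K fps_const_power flip: fps_const_mult)
  hence gf: "fps_of_poly D * Abs_fps X = fps_of_poly N"
    using pentadiagonal_gf[of a e, OF assms(2-5)] unfolding N X_def \<epsilon>_def by (simp only:)
  have degree: "min_recurrence_degree X = 5" if "a 1 \<noteq> 0"
  proof -
    have "degree D = 5"
      using \<epsilon>0 assms(1) by (simp add: D_def N_def K_def)
    moreover have "coprime D N"
    proof -
      \<comment> \<open>\<open>N\<close> is linear, hence prime, so coprimality only requires that
        \<open>D\<close> not vanish at its root.\<close>
      have "prime_elem N"
        unfolding N_def using \<epsilon>0 assms(1) by (intro prime_elem_linear_field_poly) simp
      moreover have "\<not> N dvd D"
      proof
        assume "N dvd D"
        hence "poly D (\<epsilon> / a 2) = 0"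
          using \<epsilon>2 assms(1) by (auto simp: N_def field_simps elim!: dvdE)
        moreover have "poly D (\<epsilon> / a 2) = - 2 * \<epsilon> * (a 1)\<^sup>2 / (a 2)\<^sup>2"
          using assms(1) by (simp add: D_def N_def field_simps power2_eq_square \<epsilon>2 \<epsilon>2')
        ultimately show False using \<epsilon>0 that assms(1) by simp
      qed
      ultimately show ?thesis by (metis prime_elem_imp_coprime coprime_commute)
    qed
    moreover have "coeff D 0 = 1" by (simp add: D_def N_def K_def)
    ultimately show ?thesis
      using min_recurrence_degree_rational_gf[OF gf] by (simp add: N_def numeral_eq_enat)
  qed
  have gf_K: "fps_of_poly K * Abs_fps X = 1" if "a 1 = 0"
  proof -
    have "fps_of_poly N * (fps_of_poly K * Abs_fps X) = fps_of_poly N * 1"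
      using gf that by (simp add: D_def fps_of_poly_mult mult.assoc)
    moreover have "fps_of_poly N \<noteq> 0"
      using fps_of_poly_eq_iff[of N 0] by (simp add: N_def)
    ultimately show ?thesis by simp
  qed
  have degree_4: "min_recurrence_degree X = 4" if "a 1 = 0"
    using min_recurrence_degree_rational_gf[of K X 1] gf_K[OF that] assms(1)
    by (simp add: K_def numeral_eq_enat)
  \<comment> \<open>Coefficient \<open>n\<close> of \<open>K * X = 1\<close>, with terms of negative
    index replaced by 0. Small \<open>n\<close> give the initial values, the others the
    recurrence.\<close>
  have conv: "X n = (if n = 0 then 1 else 0) + (if n < 1 then 0 else a 0 * X (n - 1))
      + (if n < 3 then 0 else \<epsilon> * a 0 * (a 2)\<^sup>2 * X (n - 3))
      + (if n < 4 then 0 else (a 2) ^ 4 * X (n - 4))" if "a 1 = 0" for n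
  proof -
    have "Abs_fps X - fps_const (a 0) * (fps_X * Abs_fps X)
        - fps_const (\<epsilon> * a 0 * (a 2)\<^sup>2) * (fps_X ^ 3 * Abs_fps X)
        - fps_const ((a 2) ^ 4) * (fps_X ^ 4 * Abs_fps X) = 1"
      using gf_K[OF that] by (simp only: K left_diff_distrib mult.assoc mult_1_left)
    from arg_cong[OF this, of "\<lambda>f. fps_nth f n"] show ?thesis
      by (simp add: fps_mult_left_const_nth fps_X_power_mult_nth del: fps_const_mult)
        (auto simp: algebra_simps split: if_splits)
  qed
  have rec: "X (n + 4) = a 0 * X (n + 3) + \<epsilon> * a 0 * (a 2)\<^sup>2 * X (n + 1) + (a 2) ^ 4 * X n"
    if "a 1 = 0" for n
    using conv[OF that, of "n + 4"] by (simp add: numeral_eq_Suc)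
  have prods: "X (2 * k) = (F k)\<^sup>2 \<and> X (2 * k + 1) = F k * F (k + 1)" if "a 1 = 0" for k
  proof (induction k rule: less_induct)
    case (less k)
    have F: "F 0 = 1" "F (Suc 0) = a 0"
        "F (Suc (Suc k)) = a 0 * F (Suc k) + \<epsilon> * (a 2)\<^sup>2 * F k" for k
      by (simp_all add: F_def \<epsilon>_def)
    consider "k = 0" | "k = 1" | m where "k = Suc (Suc m)"
      by (metis One_nat_def not0_implies_Suc)
    thus ?case
    proof cases
      case 1
      thus ?thesis using conv[OF that, of 0] conv[OF that, of 1] by (simp add: F)
    next
      case 2
      thus ?thesis
        using conv[OF that, of 0] conv[OF that, of 1] conv[OF that, of 2] conv[OF that, of 3]
        by (simp add: F algebra_simps power2_eq_square numeral_eq_Suc)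
    next
      case (3 m)
      have IH: "X (2 * m) = (F m)\<^sup>2" "X (2 * m + 1) = F m * F (Suc m)"
          "X (2 * m + 2) = (F (Suc m))\<^sup>2" "X (2 * m + 3) = F (Suc m) * F (Suc (Suc m))"
        using less[of m] less[of "Suc m"] 3 by (simp_all add: numeral_eq_Suc)
      \<comment> \<open>Expanding one factor of \<open>F k * F k\<close> by the recurrence of
        \<open>F\<close>, and then \<open>F k\<close> once more in the term with \<open>F m\<close>,
        gives the recurrence of \<open>X\<close>; \<open>a2^4\<close> arises from
        \<open>\<epsilon> * \<epsilon> = 1\<close>. The odd case is alike.\<close>
      have "X (2 * k) = (F k)\<^sup>2"
        using rec[OF that, of "2 * m"] IH F(3)[of m] 3
        by (simp add: numeral_eq_Suc) (simp add: algebra_simps \<epsilon>2')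
      moreover have "X (2 * k + 1) = F k * F (Suc k)"
        using rec[OF that, of "2 * m + 1"] IH F(3)[of m] F(3)[of "Suc m"] 3 calculation
        by (simp add: numeral_eq_Suc) (simp add: algebra_simps \<epsilon>2')
      ultimately show ?thesis by simp
    qed
  qed
  have quotient: "Abs_fps X = 1 / fps_of_poly K" if "a 1 = 0"
  proof -
    have K0: "fps_nth (fps_of_poly K) 0 \<noteq> 0" by (simp add: K_def)
    have "inverse (fps_of_poly K) = Abs_fps X"
      using gf_K[OF that] by (rule fps_inverse_unique)
    thus ?thesis by (simp add: fps_divide_unit[OF K0])
  qed
  have "min_recurrence_degree X = (if a 1 \<noteq> 0 then 5 else 4)"
    using degree degree_4 by simp
  moreover have "a 1 = 0 \<longleftrightarrow> min_recurrence_degree X + 1 = 5"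
    using degree degree_4 by (cases "a 1 = 0") (auto simp: numeral_eq_enat one_enat_def)
  ultimately show ?thesis
    using prods rec quotient
    unfolding Let_def X_def[symmetric] F_def[symmetric] \<epsilon>_def[symmetric] K by blast
qed

end
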